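(* Given any two Stinespring representations $(\mathcal{K},\mathcal{H},\pi,V)$ and $(\mathcal{K},\mathcal{I},\rho,W)$ of an OCP map $(\mathcal{K},\varphi)$ on a $C^*$-algebra $\mathcal{A}$, there exists a unique partial isometry $L:\mathcal{H}\to\mathcal{I}$ such that (i) $(\mathcal{K},\mathcal{H},\pi,V)\xrightarrow{(\mathrm{id}_{\mathcal{K}},L)}(\mathcal{K},\mathcal{I},\rho,W)$ is a morphism of anchored representations, (ii) $L$ restricted to $\overline{\pi(\mathcal{A})V(\mathcal{K})}\subseteq\mathcal{H}$ is a unitary intertwiner onto $\overline{\rho(\mathcal{A})W(\mathcal{K})}\subseteq\mathcal{I}$, and (iii) for any other bounded linear map $M:\mathcal{H}\to\mathcal{I}$ satisfying condition (i) (with $M$ in place of $L$), $M$ agrees with $L$ on the intersection of their initial spaces (and hence also satisfies condition (ii)).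
   Context: All $C^*$-algebras and $^*$-homomorphisms (in particular all representations) are unital. $\mathcal{B}(\mathcal{K})$ denotes the bounded operators on a Hilbert space $\mathcal{K}$. An OCP map on $\mathcal{A}$ is a pair $(\mathcal{K},\varphi)$ with $\mathcal{K}$ a Hilbert space and $\varphi:\mathcal{A}\to\mathcal{B}(\mathcal{K})$ a completely positive linear map. An anchored representation of $\mathcal{A}$ is a quadruple $(\mathcal{K},\mathcal{H},\pi,V)$ with $\mathcal{K},\mathcal{H}$ Hilbert spaces, $\pi:\mathcal{A}\to\mathcal{B}(\mathcal{H})$ a $^*$-homomorphism, and $V:\mathcal{K}\to\mathcal{H}$ bounded linear. A morphism $(T,L):(\mathcal{K},\mathcal{H},\pi,V)\to(\mathcal{L},\mathcal{I},\rho,W)$ consists of bounded linear maps $T:\mathcal{K}\to\mathcal{L}$, $L:\mathcal{H}\to\mathcal{I}$ with $L\pi(a)=\rho(a)L$ for all $a\in\mathcal{A}$, $LV=WT$, and $TV^*=W^*L$. A Stinespring representation of $(\mathcal{K},\varphi)$ is an anchored representation $(\mathcal{K},\mathcal{H},\pi,V)$ with $\varphi(a)=V^*\pi(a)V$ for all $a\in\mathcal{A}$. The notation $\pi(\mathcal{A})V(\mathcal{K})$ means $\mathrm{span}\{\pi(a)V(v):a\in\mathcal{A},v\in\mathcal{K}\}$, and similarly for $\rho(\mathcal{A})W(\mathcal{K})$; overline denotes closure. The initial space of a bounded linear map $L:\mathcal{H}\to\mathcal{I}$ between Hilbert spaces is $\ker(L)^\perp\subseteq\mathcal{H}$. $L$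 is a partial isometry if it is an isometry when restricted to $\ker(L)^\perp$. *)

theory Defs
  imports "HOL-Analysis.Analysis"
begin

class scaleC =
  fixes scaleC :: "complex \<Rightarrow> 'a \<Rightarrow> 'a"  (infixr "*\<^sub>C" 75)

class complex_normed_vector = real_normed_vector + scaleC +
  assumes scaleC_add_right: "c *\<^sub>C (x + y) = c *\<^sub>C x + c *\<^sub>C y"
    and scaleC_add_left: "(c + d) *\<^sub>C x = c *\<^sub>C x + d *\<^sub>C x"
    and scaleC_scaleC: "c *\<^sub>C d *\<^sub>C x = (c * d) *\<^sub>C x"
    and scaleC_one: "1 *\<^sub>C x = x"
    and scaleR_scaleC: "r *\<^sub>R x = complex_of_real r *\<^sub>C x"
    and norm_scaleC: "norm (c *\<^sub>C x) = cmod c * norm x"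

global_interpretation complex_vector:
  vector_space "scaleC :: complex \<Rightarrow> 'a \<Rightarrow> 'a::complex_normed_vector"
  defines cspan = complex_vector.span
  by unfold_locales (simp_all add: scaleC_add_right scaleC_add_left scaleC_scaleC scaleC_one)

text \<open>
  The inner product is linear in the second argument, and the norm of the underlying
  Banach space is the one it induces.
\<close>

class chilbert_space = complex_normed_vector + complete_space +
  fixes cinner :: "'a \<Rightarrow> 'a \<Rightarrow> complex"
  assumes cinner_commute: "cinner x y = cnj (cinner y x)"
    and cinner_add_right: "cinner x (y + z) = cinner x y + cinner x z"
    and cinner_scaleC_right: "cinner x (c *\<^sub>C y) = c * cinner x y"
    and cinner_self: "cinner x x = complex_of_real ((norm x)\<^sup>2)"

definition orthogonal_complement :: "'h::chilbert_space set \<Rightarrow> 'h set" where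
  "orthogonal_complement S = {x. \<forall>y\<in>S. cinner y x = 0}"

definition bounded_clinear :: "('h::complex_normed_vector \<Rightarrow> 'i::complex_normed_vector) \<Rightarrow> bool" where
  "bounded_clinear T \<longleftrightarrow> bounded_linear T \<and> (\<forall>c x. T (c *\<^sub>C x) = c *\<^sub>C T x)"

text \<open>Only meaningful for bounded operators; existence is the Riesz representation theorem.\<close>

definition cadjoint :: "('h::chilbert_space \<Rightarrow> 'i::chilbert_space) \<Rightarrow> 'i \<Rightarrow> 'h" where
  "cadjoint T = (THE S. \<forall>x y. cinner (S y) x = cinner y (T x))"

definition initial_space :: "('h::chilbert_space \<Rightarrow> 'i::chilbert_space) \<Rightarrow> 'h set" where
  "initial_space L = orthogonal_complement {x. L x = 0}"

definition partial_isometry :: "('h::chilbert_space \<Rightarrow> 'i::chilbert_space) \<Rightarrow> bool" where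
  "partial_isometry L \<longleftrightarrow> bounded_clinear L \<and> (\<forall>x\<in>initial_space L. norm (L x) = norm x)"

text \<open>
  The unit is required through \<open>monoid_mult\<close> rather than \<open>real_normed_algebra_1\<close>,
  since the latter would exclude the zero algebra.
\<close>

class cstar_algebra = real_normed_algebra + complex_normed_vector + monoid_mult + complete_space +
  fixes star :: "'a \<Rightarrow> 'a"
  assumes scaleC_mult_left: "(c *\<^sub>C x) * y = c *\<^sub>C (x * y)"
    and scaleC_mult_right: "x * (c *\<^sub>C y) = c *\<^sub>C (x * y)"
    and star_star: "star (star x) = x"
    and star_add: "star (x + y) = star x + star y"
    and star_scaleC: "star (c *\<^sub>C x) = cnj c *\<^sub>C star x"
    and star_mult: "star (x * y) = star y * star x"
    and norm_star_mult: "norm (star x * x) = (norm x)\<^sup>2"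

text \<open>
  An \<open>n \<times> n\<close> matrix is a function of two indices, of which only the values at indices
  below \<open>n\<close> matter.  An element of \<open>M\<^sub>n(A)\<close> is positive if it has the form \<open>X\<^sup>* X\<close>; an
  element of \<open>M\<^sub>n(B(K))\<close> is positive if it is positive as an operator on \<open>K\<^sup>n\<close>.
\<close>

definition positive_matrix :: "nat \<Rightarrow> (nat \<Rightarrow> nat \<Rightarrow> 'a::cstar_algebra) \<Rightarrow> bool" where
  "positive_matrix n A \<longleftrightarrow> (\<exists>X. \<forall>i<n. \<forall>j<n. A i j = (\<Sum>k<n. star (X k i) * X k j))"

definition positive_operator_matrix ::
    "nat \<Rightarrow> (nat \<Rightarrow> nat \<Rightarrow> 'k::chilbert_space \<Rightarrow> 'k) \<Rightarrow> bool" where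
  "positive_operator_matrix n T \<longleftrightarrow>
     (\<forall>v. (\<Sum>i<n. \<Sum>j<n. cinner (v i) (T i j (v j))) \<in> \<real>\<^sub>\<ge>\<^sub>0)"

definition completely_positive :: "('a::cstar_algebra \<Rightarrow> 'k::chilbert_space \<Rightarrow> 'k) \<Rightarrow> bool" where
  "completely_positive \<phi> \<longleftrightarrow>
     (\<forall>n A. positive_matrix n A \<longrightarrow> positive_operator_matrix n (\<lambda>i j. \<phi> (A i j)))"

definition ocp_map :: "('a::cstar_algebra \<Rightarrow> 'k::chilbert_space \<Rightarrow> 'k) \<Rightarrow> bool" where
  "ocp_map \<phi> \<longleftrightarrow>
     (\<forall>a. bounded_clinear (\<phi> a)) \<and>
     (\<forall>a b. \<phi> (a + b) = (\<lambda>v. \<phi> a v + \<phi> b v)) \<and>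
     (\<forall>c a. \<phi> (c *\<^sub>C a) = (\<lambda>v. c *\<^sub>C \<phi> a v)) \<and>
     completely_positive \<phi>"

definition representation :: "('a::cstar_algebra \<Rightarrow> 'h::chilbert_space \<Rightarrow> 'h) \<Rightarrow> bool" where
  "representation \<pi> \<longleftrightarrow>
     (\<forall>a. bounded_clinear (\<pi> a)) \<and>
     (\<forall>a b. \<pi> (a + b) = (\<lambda>x. \<pi> a x + \<pi> b x)) \<and>
     (\<forall>c a. \<pi> (c *\<^sub>C a) = (\<lambda>x. c *\<^sub>C \<pi> a x)) \<and>
     (\<forall>a b. \<pi> (a * b) = \<pi> a \<circ> \<pi> b) \<and>
     \<pi> 1 = id \<and>
     (\<forall>a. \<pi> (star a) = cadjoint (\<pi> a))"

text \<open>The Hilbert spaces of an anchored representation are given by the types.\<close>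

definition anchored_representation ::
    "('a::cstar_algebra \<Rightarrow> 'h::chilbert_space \<Rightarrow> 'h) \<Rightarrow> ('k::chilbert_space \<Rightarrow> 'h) \<Rightarrow> bool" where
  "anchored_representation \<pi> V \<longleftrightarrow> representation \<pi> \<and> bounded_clinear V"

definition anchored_morphism ::
    "('a::cstar_algebra \<Rightarrow> 'h::chilbert_space \<Rightarrow> 'h) \<Rightarrow> ('k::chilbert_space \<Rightarrow> 'h) \<Rightarrow>
     ('a \<Rightarrow> 'i::chilbert_space \<Rightarrow> 'i) \<Rightarrow> ('l::chilbert_space \<Rightarrow> 'i) \<Rightarrow>
     ('k \<Rightarrow> 'l) \<Rightarrow> ('h \<Rightarrow> 'i) \<Rightarrow> bool" where
  "anchored_morphism \<pi> V \<rho> W T L \<longleftrightarrow>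
     bounded_clinear T \<and> bounded_clinear L \<and>
     (\<forall>a. L \<circ> \<pi> a = \<rho> a \<circ> L) \<and>
     L \<circ> V = W \<circ> T \<and>
     T \<circ> cadjoint V = cadjoint W \<circ> L"

definition stinespring_representation ::
    "('a::cstar_algebra \<Rightarrow> 'k::chilbert_space \<Rightarrow> 'k) \<Rightarrow>
     ('a \<Rightarrow> 'h::chilbert_space \<Rightarrow> 'h) \<Rightarrow> ('k \<Rightarrow> 'h) \<Rightarrow> bool" where
  "stinespring_representation \<phi> \<pi> V \<longleftrightarrow>
     anchored_representation \<pi> V \<and> (\<forall>a. \<phi> a = cadjoint V \<circ> \<pi> a \<circ> V)"

definition generated_space ::
    "('a::cstar_algebra \<Rightarrow> 'h::chilbert_space \<Rightarrow> 'h) \<Rightarrow> ('k::chilbert_space \<Rightarrow> 'h) \<Rightarrow> 'h set" where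
  "generated_space \<pi> V = cspan {\<pi> a (V v) | a v. True}"

text \<open>
  \<open>L\<close> restricts to a unitary from \<open>S\<close> onto \<open>S'\<close> intertwining the restrictions of the two
  representations; for these to act on \<open>S\<close> and \<open>S'\<close>, the subspaces must be invariant.
\<close>

definition unitary_intertwiner_on ::
    "('a::cstar_algebra \<Rightarrow> 'h::chilbert_space \<Rightarrow> 'h) \<Rightarrow> 'h set \<Rightarrow>
     ('a \<Rightarrow> 'i::chilbert_space \<Rightarrow> 'i) \<Rightarrow> 'i set \<Rightarrow> ('h \<Rightarrow> 'i) \<Rightarrow> bool" where
  "unitary_intertwiner_on \<pi> S \<rho> S' L \<longleftrightarrow>
     (\<forall>a. \<pi> a ` S \<subseteq> S) \<and> (\<forall>a. \<rho> a ` S' \<subseteq> S') \<and>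
     L ` S = S' \<and>
     (\<forall>x\<in>S. \<forall>y\<in>S. cinner (L x) (L y) = cinner x y) \<and>
     (\<forall>a. \<forall>x\<in>S. L (\<pi> a x) = \<rho> a (L x))"

instantiation complex :: chilbert_space
begin
definition scaleC_complex :: "complex \<Rightarrow> complex \<Rightarrow> complex" where "scaleC_complex c x = c * x"
definition cinner_complex :: "complex \<Rightarrow> complex \<Rightarrow> complex" where "cinner_complex x y = cnj x * y"
instance
  by standard
    (simp_all add: scaleC_complex_def cinner_complex_def algebra_simps norm_mult
      scaleR_conv_of_real complex_norm_square del: of_real_power)
end

instantiation complex :: cstar_algebra
begin
definition star_complex :: "complex \<Rightarrow> complex" where "star_complex = cnj"
instance
  by standard
    (simp_all add: scaleC_complex_def star_complex_def norm_mult power2_eq_square)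
end

end

theory Submission
  imports Defs
begin

text \<open>
  Let \<open>G\<close> be the closed span of the pairs \<open>(\<pi> a (V v), \<rho> a (W v))\<close>.  Both components of such
  pairs have the inner products determined by \<open>\<phi>\<close>, so \<open>G\<close> is the graph of a unitary between
  the two generated spaces, and extending it by \<open>0\<close> gives \<open>L\<close>.  Every morphism restricts to this
  unitary and its kernel is orthogonal to the generated space.  Hence, if \<open>L'\<close> is another
  solution, the morphism \<open>2L - L'\<close> has the same kernel as \<open>L'\<close>, and (iii) for \<open>L'\<close> yields
  \<open>2L - L' = L'\<close> on the initial space of \<open>L'\<close>.
\<close>

section \<open>Hilbert spaces\<close>

lemma cinner_add_left: "cinner (x + y) z = cinner x z + cinner y (z::'h::chilbert_space)"
  using cinner_commute[of "x + y" z] cinner_commute[of x z] cinner_commute[of y z]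
  by (simp add: cinner_add_right)

lemma cinner_scaleC_left: "cinner (c *\<^sub>C x) (y::'h::chilbert_space) = cnj c * cinner x y"
  using cinner_commute[of "c *\<^sub>C x" y] cinner_commute[of x y]
  by (simp add: cinner_scaleC_right)

lemma minus_scaleC: "- x = (-1) *\<^sub>C (x::'a::complex_normed_vector)"
  using scaleR_scaleC[of "-1" x] by simp

lemma cinner_minus_right: "cinner x (- y) = - cinner x (y::'h::chilbert_space)"
  unfolding minus_scaleC[of y] cinner_scaleC_right by simp

lemma cinner_minus_left: "cinner (- x) y = - cinner x (y::'h::chilbert_space)"
  unfolding minus_scaleC[of x] cinner_scaleC_left by simp

lemma cinner_diff_right: "cinner x (y - z) = cinner x y - cinner x (z::'h::chilbert_space)"
  using cinner_add_right[of x y "- z"] by (simp add: cinner_minus_right)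

lemma cinner_diff_left: "cinner (x - y) z = cinner x z - cinner y (z::'h::chilbert_space)"
  using cinner_add_left[of x "- y" z] by (simp add: cinner_minus_left)

lemma cinner_zero_right [simp]: "cinner x (0::'h::chilbert_space) = 0"
  using cinner_diff_right[of x 0 0] by simp

lemma cinner_zero_left [simp]: "cinner (0::'h::chilbert_space) x = 0"
  using cinner_diff_left[of 0 0 x] by simp

lemma cinner_self_eq_zero_iff: "cinner x x = 0 \<longleftrightarrow> x = (0::'h::chilbert_space)"
  by (simp add: cinner_self)

lemma norm_sq_eq_Re_cinner: "(norm (x::'h::chilbert_space))\<^sup>2 = Re (cinner x x)"
  by (simp add: cinner_self)

lemma parallelogram:
  "(norm (x + y))\<^sup>2 + (norm (x - y))\<^sup>2 = 2 * (norm x)\<^sup>2 + 2 * (norm (y::'h::chilbert_space))\<^sup>2"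
  by (simp add: norm_sq_eq_Re_cinner cinner_add_left cinner_add_right cinner_diff_left cinner_diff_right)

text \<open>Pythagoras: the difference is orthogonal to \<open>y\<close>. Nonnegativity of the left
  side gives the Cauchy-Schwarz inequality; in \<open>projection_exists\<close> the formula measures
  how much a correction along \<open>y\<close> would shorten a vector.\<close>

lemma norm_sq_diff_component:
  fixes x y :: "'h::chilbert_space"
  assumes "y \<noteq> 0"
  shows "(norm (x - (cinner y x / (norm y)\<^sup>2) *\<^sub>C y))\<^sup>2 = (norm x)\<^sup>2 - (cmod (cinner y x))\<^sup>2 / (norm y)\<^sup>2"
proof -
  define c where "c = cinner y x / (norm y)\<^sup>2"
  have yy: "complex_of_real ((norm y)\<^sup>2) \<noteq> 0" using assms by simp
  have 1: "cinner y (x - c *\<^sub>C y) = 0"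
    using yy by (simp add: cinner_diff_right cinner_scaleC_right cinner_self c_def)
  have "cinner (x - c *\<^sub>C y) (x - c *\<^sub>C y) = cinner x (x - c *\<^sub>C y)"
    using 1 by (simp add: cinner_diff_left[of x] cinner_scaleC_left)
  also have "\<dots> = cinner x x - c * cnj (cinner y x)"
    using cinner_commute[of x y] by (simp add: cinner_diff_right cinner_scaleC_right)
  also have "c * cnj (cinner y x) = complex_of_real ((cmod (cinner y x))\<^sup>2 / (norm y)\<^sup>2)"
    unfolding c_def by (simp add: complex_norm_square[symmetric] del: of_real_power)
  finally have "Re (cinner (x - c *\<^sub>C y) (x - c *\<^sub>C y)) =
      Re (cinner x x) - (cmod (cinner y x))\<^sup>2 / (norm y)\<^sup>2"
    by (metis Re_complex_of_real minus_complex.sel(1))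
  then show ?thesis
    unfolding c_def norm_sq_eq_Re_cinner[symmetric] .
qed

lemma Cauchy_Schwarz_cinner: "cmod (cinner x y) \<le> norm x * norm (y::'h::chilbert_space)"
proof (cases "x = 0")
  case False
  have "0 \<le> (norm y)\<^sup>2 - (cmod (cinner x y))\<^sup>2 / (norm x)\<^sup>2"
    unfolding norm_sq_diff_component[OF False, symmetric] by (rule zero_le_power2)
  then have "(cmod (cinner x y))\<^sup>2 / (norm x)\<^sup>2 \<le> (norm y)\<^sup>2" by simp
  then have "(cmod (cinner x y))\<^sup>2 \<le> (norm x * norm y)\<^sup>2"
    using False by (simp add: pos_divide_le_eq power_mult_distrib mult.commute)
  then show ?thesis by (rule power2_le_imp_le) simp
qed simp

lemma bounded_bilinear_cinner: "bounded_bilinear (cinner :: 'h \<Rightarrow> 'h::chilbert_space \<Rightarrow> complex)"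
proof
  show "\<exists>K. \<forall>a b. cmod (cinner a (b::'h)) \<le> norm a * norm b * K"
    by (intro exI[of _ 1]) (simp add: Cauchy_Schwarz_cinner)
qed (simp_all add: cinner_add_left cinner_add_right cinner_scaleC_left cinner_scaleC_right
      scaleR_scaleC scaleC_complex_def)

lemmas continuous_on_cinner [continuous_intros] =
  bounded_bilinear.continuous_on[OF bounded_bilinear_cinner]

lemma bounded_linear_scaleC: "bounded_linear (\<lambda>x::'a::complex_normed_vector. c *\<^sub>C x)"
  by (rule bounded_linear_intro[of _ "cmod c"])
    (simp_all add: scaleC_add_right scaleR_scaleC scaleC_scaleC norm_scaleC mult.commute)

section \<open>Closed subspaces and orthogonal projection\<close>

lemma subspace_closure:
  fixes S :: "'a::complex_normed_vector set"
  assumes "complex_vector.subspace S"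
  shows "complex_vector.subspace (closure S)"
proof (rule complex_vector.subspaceI)
  show "0 \<in> closure S"
    using assms closure_subset complex_vector.subspace_0 by blast
next
  fix x y assume "x \<in> closure S" "y \<in> closure S"
  then obtain f g where "\<And>n. f n \<in> S" "f \<longlonglongrightarrow> x" "\<And>n. g n \<in> S" "g \<longlonglongrightarrow> y"
    unfolding closure_sequential by blast
  then show "x + y \<in> closure S"
    unfolding closure_sequential using assms
    by (intro exI[of _ "\<lambda>n. f n + g n"]) (auto intro: tendsto_add complex_vector.subspace_add)
next
  fix c x assume "x \<in> closure S"
  then obtain f where "\<And>n. f n \<in> S" "f \<longlonglongrightarrow> x"
    unfolding closure_sequential by blast
  then show "c *\<^sub>C x \<in> closure S"
    unfolding closure_sequential using assms
    by (intro exI[of _ "\<lambda>n. c *\<^sub>C f n"])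
      (auto intro: bounded_linear.tendsto[OF bounded_linear_scaleC] complex_vector.subspace_scale)
qed

lemma closure_cspan_minimal:
  fixes C :: "'a::complex_normed_vector set"
  assumes "X \<subseteq> C" "complex_vector.subspace C" "closed C"
  shows "closure (cspan X) \<subseteq> C"
  using assms by (intro closure_minimal complex_vector.span_minimal)

text \<open>The projection is the point of \<open>S\<close> nearest to \<open>x\<close>. By the
  parallelogram law a minimizing sequence is Cauchy, its limit attains the distance, and minimality
  forces the residual to be orthogonal to \<open>S\<close>.\<close>

lemma projection_exists:
  fixes S :: "'h::chilbert_space set"
  assumes S: "complex_vector.subspace S" and cl: "closed S"
  shows "\<exists>p\<in>S. x - p \<in> orthogonal_complement S"
proof -
  define d where "d = infdist x S"
  have ne: "S \<noteq> {}" using complex_vector.subspace_0[OF S] by auto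
  have d_le: "d \<le> norm (x - p)" if "p \<in> S" for p
    using infdist_le[OF that, of x] by (simp add: d_def dist_norm)
  have d0: "0 \<le> d" by (simp add: d_def infdist_nonneg)
  have "\<exists>p\<in>S. norm (x - p) < d + 1 / real (Suc n)" for n
  proof -
    have "infdist x S < d + 1 / real (Suc n)" by (simp add: d_def)
    then show ?thesis
      unfolding infdist_notempty[OF ne]
      by (subst (asm) cINF_less_iff) (auto simp: ne dist_norm intro!: bdd_belowI2[of _ 0])
  qed
  then obtain p where pS: "\<And>n. p n \<in> S" and pd: "\<And>n. norm (x - p n) < d + 1 / real (Suc n)"
    by metis
  \<comment> \<open>The midpoint of \<open>u\<close> and \<open>v\<close> lies in \<open>S\<close>,
    so it is at distance at least \<open>d\<close> from \<open>x\<close>. The parallelogram law for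
    \<open>x - u\<close> and \<open>x - v\<close> turns this into a bound on
    \<open>u - v\<close>.\<close>
  have mid: "(norm (u - v))\<^sup>2 \<le> 2 * (norm (x - u))\<^sup>2 + 2 * (norm (x - v))\<^sup>2 - 4 * d\<^sup>2"
    if "u \<in> S" "v \<in> S" for u v
  proof -
    have "(1/2) *\<^sub>C (u + v) \<in> S"
      using that S by (intro complex_vector.subspace_scale complex_vector.subspace_add)
    then have "d \<le> norm (x - (1/2) *\<^sub>C (u + v))" by (rule d_le)
    also have "(1/2) *\<^sub>C (u + v) = (1/2::real) *\<^sub>R (u + v)" by (simp add: scaleR_scaleC)
    also have "x - (1/2::real) *\<^sub>R (u + v) = (1/2::real) *\<^sub>R ((x - u) + (x - v))"
      by (simp add: algebra_simps flip: scaleR_add_left)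
    finally have "2 * d \<le> norm ((x - u) + (x - v))" by simp
    then have "(2 * d)\<^sup>2 \<le> (norm ((x - u) + (x - v)))\<^sup>2"
      using d0 by (intro power_mono) auto
    then show ?thesis
      using parallelogram[of "x - u" "x - v"]
      by (simp add: power_mult_distrib norm_minus_commute)
  qed
  have lim: "(\<lambda>n. norm (x - p n)) \<longlonglongrightarrow> d"
  proof (rule tendsto_sandwich)
    show "\<forall>\<^sub>F n in sequentially. d \<le> norm (x - p n)" using d_le pS by simp
    show "\<forall>\<^sub>F n in sequentially. norm (x - p n) \<le> d + 1 / real (Suc n)"
      using pd by (intro always_eventually allI less_imp_le)
    show "(\<lambda>n. d + 1 / real (Suc n)) \<longlonglongrightarrow> d"
      using tendsto_add[OF tendsto_const[of d] LIMSEQ_inverse_real_of_nat]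
      by (simp add: inverse_eq_divide)
  qed simp
  have "Cauchy p"
  proof (rule CauchyI)
    fix e :: real assume e: "0 < e"
    have "(\<lambda>n. (norm (x - p n))\<^sup>2) \<longlonglongrightarrow> d\<^sup>2" using lim by (intro tendsto_intros)
    \<comment> \<open>The margin is chosen so that in \<open>mid\<close> the two excess terms add up
      to exactly the square of \<open>e\<close>.\<close>
    then have "\<forall>\<^sub>F n in sequentially. (norm (x - p n))\<^sup>2 < d\<^sup>2 + e\<^sup>2 / 4"
      using e by (intro order_tendstoD) auto
    then obtain N where N: "\<And>n. n \<ge> N \<Longrightarrow> (norm (x - p n))\<^sup>2 < d\<^sup>2 + e\<^sup>2 / 4"
      by (auto simp: eventually_sequentially)
    have "norm (p m - p n) < e" if "m \<ge> N" "n \<ge> N" for m n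
    proof -
      have "(norm (p m - p n))\<^sup>2 < e\<^sup>2"
        using mid[OF pS pS, of m n] N[OF that(1)] N[OF that(2)] by linarith
      then show ?thesis using e power2_less_imp_less by fastforce
    qed
    then show "\<exists>M. \<forall>m\<ge>M. \<forall>n\<ge>M. norm (p m - p n) < e" by blast
  qed
  then obtain q where q: "p \<longlonglongrightarrow> q" using Cauchy_convergent_iff convergent_def by blast
  have qS: "q \<in> S" using cl pS q by (meson closed_sequentially)
  have "(\<lambda>n. norm (x - p n)) \<longlonglongrightarrow> norm (x - q)" using q by (intro tendsto_intros)
  then have qd: "norm (x - q) = d" using lim LIMSEQ_unique by blast
  have "cinner y (x - q) = 0" if y: "y \<in> S" for y
  proof (cases "y = 0")
    case False
    \<comment> \<open>If the residual had a component along \<open>y\<close>, subtracting it would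
      yield a point of \<open>S\<close> closer to \<open>x\<close> than \<open>d\<close>.\<close>
    define c where "c = cinner y (x - q) / (norm y)\<^sup>2"
    have "q + c *\<^sub>C y \<in> S"
      using qS y S by (intro complex_vector.subspace_scale complex_vector.subspace_add)
    then have "d \<le> norm (x - q - c *\<^sub>C y)" using d_le by (metis diff_diff_add)
    then have "(norm (x - q))\<^sup>2 \<le> (norm (x - q - c *\<^sub>C y))\<^sup>2"
      using qd d0 by (intro power_mono) auto
    then have "(cmod (cinner y (x - q)))\<^sup>2 / (norm y)\<^sup>2 \<le> 0"
      unfolding c_def norm_sq_diff_component[OF False] by linarith
    then show ?thesis using False by (simp add: divide_le_0_iff)
  qed simp
  then show ?thesis using qS by (auto simp: orthogonal_complement_def)
qed

lemma orthogonal_complement_subspace: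
  "complex_vector.subspace (orthogonal_complement (S :: 'h::chilbert_space set))"
  by (rule complex_vector.subspaceI)
    (auto simp: orthogonal_complement_def cinner_add_right cinner_scaleC_right)

text \<open>The residual \<open>x - p\<close> of the projection is orthogonal both to
  \<open>x\<close> and to \<open>p\<close>, hence to itself, so it is zero.\<close>

lemma double_orthogonal_complement_subset:
  fixes S :: "'h::chilbert_space set"
  assumes "complex_vector.subspace S" "closed S"
  shows "orthogonal_complement (orthogonal_complement S) \<subseteq> S"
proof
  fix x assume x: "x \<in> orthogonal_complement (orthogonal_complement S)"
  obtain p where p: "p \<in> S" "x - p \<in> orthogonal_complement S"
    using projection_exists[OF assms] by blast
  have "cinner (x - p) x = 0" using x p(2) by (simp add: orthogonal_complement_def)
  moreover have "cinner (x - p) p = 0"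
    using p cinner_commute[of "x - p" p] by (simp add: orthogonal_complement_def)
  ultimately have "x - p = 0"
    using cinner_diff_right[of "x - p" x p] cinner_self_eq_zero_iff[of "x - p"] by simp
  then show "x \<in> S" using p(1) by simp
qed

section \<open>Bounded operators\<close>

lemma bounded_clinear_bounded_linear: "bounded_clinear T \<Longrightarrow> bounded_linear T"
  by (simp add: bounded_clinear_def)

lemma bounded_clinear_scaleC: "bounded_clinear T \<Longrightarrow> T (c *\<^sub>C x) = c *\<^sub>C T x"
  by (simp add: bounded_clinear_def)

lemma bounded_clinear_add: "bounded_clinear T \<Longrightarrow> T (x + y) = T x + T y"
  by (simp add: bounded_clinear_def linear_simps)

lemma bounded_clinear_diff: "bounded_clinear T \<Longrightarrow> T (x - y) = T x - T y"
  by (simp add: bounded_clinear_def linear_simps)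

lemma bounded_clinear_zero: "bounded_clinear T \<Longrightarrow> T 0 = 0"
  by (simp add: bounded_clinear_def linear_simps)

lemmas bounded_clinear_simps =
  bounded_clinear_scaleC bounded_clinear_add bounded_clinear_diff bounded_clinear_zero

lemma bounded_clinear_continuous_on:
  "bounded_clinear T \<Longrightarrow> continuous_on X f \<Longrightarrow> continuous_on X (\<lambda>x. T (f x))"
  using bounded_linear.continuous_on bounded_clinear_bounded_linear by blast

lemma kernel_subspace: "bounded_clinear T \<Longrightarrow> complex_vector.subspace {x. T x = 0}"
  by (rule complex_vector.subspaceI)
    (auto simp: bounded_clinear_simps complex_vector.scale_zero_right)

lemma kernel_closed: "bounded_clinear T \<Longrightarrow> closed {x. T x = 0}"
  by (rule closed_Collect_eq[OF bounded_clinear_continuous_on[OF _ continuous_on_id] continuous_on_const])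

section \<open>The Riesz representation theorem and adjoints\<close>

lemma Riesz_representation:
  fixes f :: "'h::chilbert_space \<Rightarrow> complex"
  assumes f: "bounded_clinear f"
  shows "\<exists>z. \<forall>x. cinner z x = f x"
proof (cases "\<forall>x. f x = 0")
  case False
  then obtain x0 where x0: "f x0 \<noteq> 0" by blast
  obtain p where p: "f p = 0" "x0 - p \<in> orthogonal_complement {x. f x = 0}"
    using projection_exists[OF kernel_subspace[OF f] kernel_closed[OF f], of x0] by blast
  define w where "w = x0 - p"
  have fw: "f w \<noteq> 0" using x0 p f by (simp add: w_def bounded_clinear_diff)
  then have "w \<noteq> 0" using bounded_clinear_zero[OF f] by auto
  then have ww: "cinner w w \<noteq> 0" by (simp add: cinner_self_eq_zero_iff)
  have "cinner (cnj (f w / cinner w w) *\<^sub>C w) x = f x" for x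
  proof -
    \<comment> \<open>The combination of \<open>x\<close> and \<open>w\<close> that \<open>f\<close>
      kills is orthogonal to \<open>w\<close>, since \<open>w\<close> is orthogonal to the kernel.
      Solving this relation for \<open>f x\<close> shows that the chosen multiple of
      \<open>w\<close> represents \<open>f\<close>.\<close>
    have "f (f w *\<^sub>C x - f x *\<^sub>C w) = 0"
      using f by (simp add: bounded_clinear_simps scaleC_complex_def)
    then have "cinner (f w *\<^sub>C x - f x *\<^sub>C w) w = 0"
      using p(2) by (simp add: w_def orthogonal_complement_def)
    then have "cinner w (f w *\<^sub>C x - f x *\<^sub>C w) = 0"
      by (subst cinner_commute) simp
    then show ?thesis
      using ww by (simp add: cinner_diff_right cinner_scaleC_right cinner_scaleC_left field_simps)
  qed
  then show ?thesis by blast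
qed (auto intro: exI[of _ 0])

lemma cinner_left_eqI: "(\<And>x. cinner y x = cinner z x) \<Longrightarrow> y = (z::'h::chilbert_space)"
  using cinner_self_eq_zero_iff[of "y - z"] by (simp add: cinner_diff_left)

lemma cinner_right_eqI: "(\<And>x. cinner x y = cinner x z) \<Longrightarrow> y = (z::'h::chilbert_space)"
  using cinner_self_eq_zero_iff[of "y - z"] by (simp add: cinner_diff_right)

text \<open>Justifies the definite description in \<open>cadjoint\<close>: Riesz, applied for each
  \<open>y\<close> to the functional sending \<open>x\<close> to \<open>cinner y (T x)\<close>,
  gives existence, and definiteness of the inner product gives uniqueness.\<close>

lemma cinner_cadjoint_left:
  fixes T :: "'h::chilbert_space \<Rightarrow> 'i::chilbert_space"
  assumes T: "bounded_clinear T"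
  shows "cinner (cadjoint T y) x = cinner y (T x)"
proof -
  have "bounded_clinear (\<lambda>x. cinner y (T x))" for y
    unfolding bounded_clinear_def
    using bounded_linear_compose[OF bounded_bilinear.bounded_linear_right[OF bounded_bilinear_cinner]
        bounded_clinear_bounded_linear[OF T]] T
    by (simp add: bounded_clinear_simps cinner_scaleC_right scaleC_complex_def)
  from Riesz_representation[OF this] obtain S
    where S: "\<forall>x y. cinner (S y) x = cinner y (T x)" by metis
  have "S' = S" if "\<forall>x y. cinner (S' y) x = cinner y (T x)" for S'
  proof
    show "S' y = S y" for y by (rule cinner_left_eqI) (simp add: S that)
  qed
  with S have "\<forall>x y. cinner (cadjoint T y) x = cinner y (T x)"
    unfolding cadjoint_def by (intro theI[where P = "\<lambda>S. \<forall>x y. cinner (S y) x = cinner y (T x)"])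
  then show ?thesis by blast
qed

lemma cinner_cadjoint_right:
  fixes T :: "'h::chilbert_space \<Rightarrow> 'i::chilbert_space"
  assumes "bounded_clinear T"
  shows "cinner x (cadjoint T y) = cinner (T x) y"
  using cinner_cadjoint_left[OF assms, of y x] cinner_commute[of x "cadjoint T y"]
    cinner_commute[of "T x" y] by simp

lemma bounded_clinear_cadjoint:
  fixes T :: "'h::chilbert_space \<Rightarrow> 'i::chilbert_space"
  assumes T: "bounded_clinear T"
  shows "bounded_clinear (cadjoint T)"
proof -
  have add: "cadjoint T (x + y) = cadjoint T x + cadjoint T y" for x y
    by (rule cinner_left_eqI) (simp add: cinner_cadjoint_left[OF T] cinner_add_left)
  have scale: "cadjoint T (c *\<^sub>C x) = c *\<^sub>C cadjoint T x" for c x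
    by (rule cinner_left_eqI) (simp add: cinner_cadjoint_left[OF T] cinner_scaleC_left)
  obtain K where K: "0 < K" "\<And>x. norm (T x) \<le> norm x * K"
    using bounded_linear.pos_bounded[OF bounded_clinear_bounded_linear[OF T]] by blast
  have "norm (cadjoint T x) \<le> norm x * K" for x
  proof (cases "cadjoint T x = 0")
    case False
    \<comment> \<open>Moving one adjoint across the inner product allows a bound with a single
      factor \<open>norm (cadjoint T x)\<close>, which then cancels.\<close>
    have "(norm (cadjoint T x))\<^sup>2 = cmod (cinner x (T (cadjoint T x)))"
      using cinner_self[of "cadjoint T x"]
      by (simp add: cinner_cadjoint_left[OF T] norm_power del: of_real_power)
    also have "\<dots> \<le> norm x * norm (T (cadjoint T x))" by (rule Cauchy_Schwarz_cinner)
    also have "\<dots> \<le> norm x * (norm (cadjoint T x) * K)" using K by (intro mult_left_mono) auto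
    finally show ?thesis using False by (simp add: power2_eq_square mult.assoc mult.left_commute)
  qed (use K in simp)
  then have "bounded_linear (cadjoint T)"
    by (intro bounded_linear_intro) (simp_all add: add scale scaleR_scaleC)
  then show ?thesis using scale by (simp add: bounded_clinear_def)
qed

section \<open>Isometric graphs\<close>

text \<open>Lets complex spans and their closures be formed among pairs, so that an operator can be
  built from its graph.\<close>

instantiation prod :: (complex_normed_vector, complex_normed_vector) complex_normed_vector
begin
definition scaleC_prod :: "complex \<Rightarrow> 'a \<times> 'b \<Rightarrow> 'a \<times> 'b"
  where "scaleC_prod c p = (c *\<^sub>C fst p, c *\<^sub>C snd p)"
instance
proof
  show "norm (c *\<^sub>C x) = cmod c * norm x" for c and x :: "'a \<times> 'b"
    by (simp add: scaleC_prod_def norm_prod_def norm_scaleC power_mult_distrib real_sqrt_mult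
        flip: distrib_left)
qed (simp_all add: scaleC_prod_def prod_eq_iff scaleC_add_right scaleC_add_left scaleC_scaleC
      scaleC_one scaleR_scaleC)
end

lemma fst_scaleC [simp]: "fst (c *\<^sub>C p) = c *\<^sub>C fst p"
  and snd_scaleC [simp]: "snd (c *\<^sub>C p) = c *\<^sub>C snd p"
  by (simp_all add: scaleC_prod_def)

lemma image_cspan:
  fixes f :: "'a::complex_normed_vector \<Rightarrow> 'b::complex_normed_vector"
  assumes add: "\<And>x y. f (x + y) = f x + f y" and scale: "\<And>c x. f (c *\<^sub>C x) = c *\<^sub>C f x"
  shows "f ` cspan X = cspan (f ` X)"
proof -
  interpret vector_space_pair "scaleC :: complex \<Rightarrow> 'a \<Rightarrow> 'a" "scaleC :: complex \<Rightarrow> 'b \<Rightarrow> 'b"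
    by unfold_locales
  have "Vector_Spaces.linear scaleC scaleC f"
    by unfold_locales (simp_all add: add scale)
  then show ?thesis unfolding cspan_def by (rule linear_span_image[symmetric])
qed

lemma image_closure_of_bounded_below:
  fixes f :: "'a::{complex_normed_vector,complete_space} \<Rightarrow> 'b::real_normed_vector"
  assumes G: "complex_vector.subspace G" and f: "bounded_linear f"
    and below: "\<And>x. x \<in> G \<Longrightarrow> norm x \<le> K * norm (f x)" and K: "0 < K"
  shows "f ` closure G = closure (f ` G)"
proof
  show "f ` closure G \<subseteq> closure (f ` G)"
    by (rule closure_bounded_linear_image_subset[OF f])
next
  show "closure (f ` G) \<subseteq> f ` closure G"
  proof
    fix y assume "y \<in> closure (f ` G)"
    then have "\<exists>h. (\<forall>n. h n \<in> f ` G) \<and> h \<longlonglongrightarrow> y" by (simp only: closure_sequential)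
    then obtain h where h: "\<forall>n. h n \<in> f ` G" "h \<longlonglongrightarrow> y" by (elim exE conjE)
    have "\<forall>n. \<exists>x. x \<in> G \<and> f x = h n" using h(1) by (metis imageE)
    then obtain g where g: "\<And>n. g n \<in> G" "\<And>n. f (g n) = h n" by metis
    have dist: "dist (g m) (g n) \<le> K * dist (h m) (h n)" for m n
      using below[OF complex_vector.subspace_diff[OF G g(1) g(1)], of m n]
      by (simp add: dist_norm linear_diff[OF bounded_linear.linear[OF f]] g(2))
    have "Cauchy g"
    proof (rule metric_CauchyI)
      fix e :: real assume "0 < e"
      then have "0 < e / K" using K by simp
      from metric_CauchyD[OF LIMSEQ_imp_Cauchy[OF h(2)] this] obtain N
        where N: "\<And>m n. m \<ge> N \<Longrightarrow> n \<ge> N \<Longrightarrow> dist (h m) (h n) < e / K" by blast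
      have "dist (g m) (g n) < e" if "m \<ge> N" "n \<ge> N" for m n
      proof -
        have "K * dist (h m) (h n) < e" using N[OF that] K by (simp add: field_simps)
        then show ?thesis using dist[of m n] by linarith
      qed
      then show "\<exists>N. \<forall>m\<ge>N. \<forall>n\<ge>N. dist (g m) (g n) < e" by blast
    qed
    then obtain x where x: "g \<longlonglongrightarrow> x" using Cauchy_convergent_iff convergent_def by blast
    then have "h \<longlonglongrightarrow> f x" using bounded_linear.tendsto[OF f x] by (simp add: g(2))
    then have "y = f x" using h(2) LIMSEQ_unique by blast
    moreover have "x \<in> closure G" unfolding closure_sequential using g(1) x by blast
    ultimately show "y \<in> f ` closure G" by blast
  qed
qed

text \<open>On \<open>G\<close> the norm of a pair is at most the sum of two equal norms, so both
  coordinate projections are bounded below with constant 2.\<close>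

lemma isometric_graph_image_closure:
  fixes G :: "('h::{complex_normed_vector,complete_space} \<times> 'i::{complex_normed_vector,complete_space}) set"
  assumes G: "complex_vector.subspace G" and iso: "\<And>p. p \<in> G \<Longrightarrow> norm (fst p) = norm (snd p)"
  shows "fst ` closure G = closure (fst ` G)" and "snd ` closure G = closure (snd ` G)"
proof -
  have "norm p \<le> norm (fst p) + norm (snd p)" for p :: "'h \<times> 'i"
    using norm_Pair_le[of "fst p" "snd p"] by simp
  then have "norm p \<le> 2 * norm (fst p)" "norm p \<le> 2 * norm (snd p)" if "p \<in> G" for p
    using iso[OF that] by (metis mult_2)+
  then show "fst ` closure G = closure (fst ` G)" "snd ` closure G = closure (snd ` G)"
    by (intro image_closure_of_bounded_below[OF G, of _ 2] bounded_linear_fst bounded_linear_snd; simp)+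
qed

lemma partial_isometry_of_graph:
  fixes G :: "('h::chilbert_space \<times> 'i::chilbert_space) set"
  assumes G: "complex_vector.subspace G" and cl: "closed (fst ` G)"
    and iso: "\<And>p. p \<in> G \<Longrightarrow> norm (fst p) = norm (snd p)"
  obtains L where "partial_isometry L" "\<And>x y. (x, y) \<in> G \<Longrightarrow> L x = y"
    "\<And>x. x \<in> orthogonal_complement (fst ` G) \<Longrightarrow> L x = 0" "initial_space L \<subseteq> fst ` G"
proof -
  let ?S = "fst ` G"
  have S: "complex_vector.subspace ?S"
  proof (rule complex_vector.subspaceI)
    show "0 \<in> ?S" using complex_vector.subspace_0[OF G] by force
    show "x + y \<in> ?S" if "x \<in> ?S" "y \<in> ?S" for x y
      using that complex_vector.subspace_add[OF G] by (metis (no_types) fst_add imageE imageI)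
    show "c *\<^sub>C x \<in> ?S" if "x \<in> ?S" for c x
      using that complex_vector.subspace_scale[OF G] by (metis (no_types) fst_scaleC imageE imageI)
  qed
  \<comment> \<open>\<open>R x y\<close> says that \<open>y\<close> is the partner of the projection
    of \<open>x\<close>. Working with a relation makes linearity a closure property, and
    single-valuedness can be derived afterwards.\<close>
  define R where "R x y \<longleftrightarrow> (\<exists>p. (p, y) \<in> G \<and> x - p \<in> orthogonal_complement ?S)" for x y
  have R_ex: "\<exists>y. R x y" for x
    using projection_exists[OF S cl, of x] unfolding R_def by force
  \<comment> \<open>By Pythagoras the projection does not increase the norm, and \<open>G\<close>
    preserves it. This bounds \<open>L\<close> and also yields \<open>R_unique\<close>.\<close>
  have R_norm: "norm y \<le> norm x" if "R x y" for x y
  proof -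
    from that obtain p where p: "(p, y) \<in> G" "x - p \<in> orthogonal_complement ?S"
      unfolding R_def by blast
    then have o: "cinner p (x - p) = 0" by (force simp: orthogonal_complement_def)
    then have "cinner (x - p) p = 0" by (subst cinner_commute) simp
    then have "cinner x x = cinner p p + cinner (x - p) (x - p)"
      using o by (simp add: cinner_diff_left cinner_diff_right)
    then have "(norm x)\<^sup>2 = (norm p)\<^sup>2 + (norm (x - p))\<^sup>2"
      unfolding norm_sq_eq_Re_cinner by (metis plus_complex.sel(1))
    then have "(norm p)\<^sup>2 \<le> (norm x)\<^sup>2" by simp
    then have "norm p \<le> norm x" by (rule power2_le_imp_le) simp
    then show ?thesis using iso[OF p(1)] by simp
  qed
  have R_add: "R (x + x') (y + y')" if "R x y" "R x' y'" for x x' y y'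
  proof -
    from that obtain p p' where p: "(p, y) \<in> G" "x - p \<in> orthogonal_complement ?S"
      "(p', y') \<in> G" "x' - p' \<in> orthogonal_complement ?S"
      unfolding R_def by blast
    have "(p + p', y + y') \<in> G" using complex_vector.subspace_add[OF G p(1,3)] by simp
    moreover have "x + x' - (p + p') \<in> orthogonal_complement ?S"
      using complex_vector.subspace_add[OF orthogonal_complement_subspace p(2,4)]
      by (simp add: algebra_simps)
    ultimately show ?thesis unfolding R_def by blast
  qed
  have R_scale: "R (c *\<^sub>C x) (c *\<^sub>C y)" if "R x y" for c x y
  proof -
    from that obtain p where p: "(p, y) \<in> G" "x - p \<in> orthogonal_complement ?S"
      unfolding R_def by blast
    have "(c *\<^sub>C p, c *\<^sub>C y) \<in> G"
      using complex_vector.subspace_scale[OF G p(1)] by (simp add: scaleC_prod_def)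
    moreover have "c *\<^sub>C x - c *\<^sub>C p \<in> orthogonal_complement ?S"
      using complex_vector.subspace_scale[OF orthogonal_complement_subspace p(2)]
      by (simp add: complex_vector.scale_right_diff_distrib)
    ultimately show ?thesis unfolding R_def by blast
  qed
  \<comment> \<open>Subtracting the two relations relates 0 to \<open>y - y'\<close>, which
    \<open>R_norm\<close> forces to be 0.\<close>
  have R_unique: "y = y'" if "R x y" "R x y'" for x y y'
  proof -
    have "R (x + (-1) *\<^sub>C x) (y + (-1) *\<^sub>C y')" using that by (intro R_add R_scale)
    then show ?thesis using R_norm by fastforce
  qed
  obtain L where L: "\<And>x. R x (L x)" using R_ex by metis
  have L_eq: "L x = y" if "R x y" for x y using R_unique[OF L that] .
  have add: "L (x + y) = L x + L y" for x y by (intro L_eq R_add L)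
  have scale: "L (c *\<^sub>C x) = c *\<^sub>C L x" for c x by (intro L_eq R_scale L)
  have "bounded_linear L"
    using R_norm[OF L] by (intro bounded_linear_intro[of _ 1]) (simp_all add: add scale scaleR_scaleC)
  then have bl: "bounded_clinear L" by (simp add: bounded_clinear_def scale)
  have L_graph: "L x = y" if "(x, y) \<in> G" for x y
    using that complex_vector.subspace_0[OF orthogonal_complement_subspace]
    by (intro L_eq) (auto simp: R_def intro!: exI[of _ x])
  have L_orth: "L x = 0" if "x \<in> orthogonal_complement ?S" for x
    using that complex_vector.subspace_0[OF G]
    by (intro L_eq) (auto simp: R_def zero_prod_def intro!: exI[of _ 0])
  \<comment> \<open>Passing to orthogonal complements reverses the inclusion of the complement of
    the domain in the kernel of \<open>L\<close>.\<close>
  have "initial_space L \<subseteq> orthogonal_complement (orthogonal_complement ?S)"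
    using L_orth by (auto simp: initial_space_def orthogonal_complement_def)
  then have init: "initial_space L \<subseteq> ?S"
    using double_orthogonal_complement_subset[OF S cl] by blast
  then have "norm (L x) = norm x" if "x \<in> initial_space L" for x
    using that iso L_graph by fastforce
  then have pi: "partial_isometry L" using bl by (simp add: partial_isometry_def)
  show ?thesis by (rule that[OF pi]) (use L_graph L_orth init in blast)+
qed

section \<open>Stinespring representations\<close>

lemma representation_bounded: "representation \<pi> \<Longrightarrow> bounded_clinear (\<pi> a)"
  by (simp add: representation_def)

lemma cinner_representation:
  assumes "representation \<pi>"
  shows "cinner (\<pi> a x) y = cinner x (\<pi> (star a) y)"
  using assms cinner_cadjoint_right[of "\<pi> a" x y] by (simp add: representation_def)

lemma cinner_representation_star:
  assumes "representation \<pi>"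
  shows "cinner (\<pi> (star a) x) y = cinner x (\<pi> a y)"
  using cinner_representation[OF assms, of "star a"] by (simp add: star_star)

text \<open>The right side involves only \<phi>, so any two Stinespring representations of \<phi>
  give their generating vectors the same inner products.\<close>

lemma cinner_stinespring:
  assumes "stinespring_representation \<phi> \<pi> V"
  shows "cinner (\<pi> a (V v)) (\<pi> b (V w)) = cinner v (\<phi> (star a * b) w)"
proof -
  have \<pi>: "representation \<pi>" and V: "bounded_clinear V"
    and \<phi>: "\<phi> (star a * b) w = cadjoint V (\<pi> (star a * b) (V w))"
    using assms by (auto simp: stinespring_representation_def anchored_representation_def)
  have "\<pi> (star a) (\<pi> b (V w)) = \<pi> (star a * b) (V w)"
    using \<pi> by (simp add: representation_def)
  then show ?thesis
    by (simp add: cinner_representation[OF \<pi>] \<phi> cinner_cadjoint_right[OF V])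
qed

definition intertwining_pairs ::
    "('a::cstar_algebra \<Rightarrow> 'h::chilbert_space \<Rightarrow> 'h) \<Rightarrow> ('k::chilbert_space \<Rightarrow> 'h) \<Rightarrow>
     ('a \<Rightarrow> 'i::chilbert_space \<Rightarrow> 'i) \<Rightarrow> ('k \<Rightarrow> 'i) \<Rightarrow> ('h \<times> 'i) set" where
  "intertwining_pairs \<pi> V \<rho> W = {(\<pi> a (V v), \<rho> a (W v)) | a v. True}"

section \<open>The graph of the unitary between the generated spaces\<close>

locale two_stinespring =
  fixes \<phi> :: "'a::cstar_algebra \<Rightarrow> 'k::chilbert_space \<Rightarrow> 'k"
    and \<pi> :: "'a \<Rightarrow> 'h::chilbert_space \<Rightarrow> 'h" and V :: "'k \<Rightarrow> 'h"
    and \<rho> :: "'a \<Rightarrow> 'i::chilbert_space \<Rightarrow> 'i" and W :: "'k \<Rightarrow> 'i"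
  assumes \<pi>V: "stinespring_representation \<phi> \<pi> V"
    and \<rho>W: "stinespring_representation \<phi> \<rho> W"
begin

lemma rep_\<pi>: "representation \<pi>" and bounded_V: "bounded_clinear V"
  and rep_\<rho>: "representation \<rho>" and bounded_W: "bounded_clinear W"
  using \<pi>V \<rho>W by (auto simp: stinespring_representation_def anchored_representation_def)

lemmas bounded_\<pi> = representation_bounded[OF rep_\<pi>]
lemmas bounded_\<rho> = representation_bounded[OF rep_\<rho>]

abbreviation pairs where "pairs \<equiv> intertwining_pairs \<pi> V \<rho> W"
abbreviation G where "G \<equiv> closure (cspan pairs)"
abbreviation S where "S \<equiv> closure (generated_space \<pi> V)"
abbreviation S' where "S' \<equiv> closure (generated_space \<rho> W)"

lemma pairsI: "(\<pi> a (V v), \<rho> a (W v)) \<in> pairs"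
  by (auto simp: intertwining_pairs_def)

lemma pairs_subset_G: "pairs \<subseteq> G"
  using closure_subset complex_vector.span_superset by blast

text \<open>This is the generating pair at \<open>a = 1\<close>, since representations are
  unital.\<close>

lemma pair_V_W: "(V v, W v) \<in> G"
  using pairs_subset_G pairsI[of 1 v] rep_\<pi> rep_\<rho> by (auto simp: representation_def)

lemma G_subspace: "complex_vector.subspace G"
  by (intro subspace_closure complex_vector.subspace_span)

text \<open>A closed subspace containing the generating pairs contains \<open>G\<close>. Facts about
  \<open>G\<close> thus reduce to generators once the property is seen to be linear and
  closed.\<close>

lemma G_induct:
  assumes "p \<in> G"
    and "\<And>a v. P (\<pi> a (V v), \<rho> a (W v))"
    and "complex_vector.subspace {p. P p}" "closed {p. P p}"
  shows "P p"
  using assms closure_cspan_minimal[of pairs "{p. P p}"] by (auto simp: intertwining_pairs_def)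

text \<open>Two nested inductions: first on \<open>p\<close> with \<open>q\<close> fixed, then on
  \<open>q\<close> with \<open>p\<close> a generator. For two generators both sides are the same
  expression in \<phi>.\<close>

lemma G_cinner:
  assumes "p \<in> G" "q \<in> G"
  shows "cinner (fst p) (fst q) = cinner (snd p) (snd q)"
  using assms(1)
proof (rule G_induct)
  show "complex_vector.subspace {p. cinner (fst p) (fst q) = cinner (snd p) (snd q)}"
    by (rule complex_vector.subspaceI) (auto simp: cinner_add_left cinner_scaleC_left)
  show "closed {p. cinner (fst p) (fst q) = cinner (snd p) (snd q)}"
    by (intro closed_Collect_eq continuous_intros)
next
  fix a v
  let ?p = "(\<pi> a (V v), \<rho> a (W v))"
  show "cinner (fst ?p) (fst q) = cinner (snd ?p) (snd q)"
    using assms(2)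
  proof (rule G_induct)
    show "complex_vector.subspace {q. cinner (fst ?p) (fst q) = cinner (snd ?p) (snd q)}"
      by (rule complex_vector.subspaceI) (auto simp: cinner_add_right cinner_scaleC_right)
    show "closed {q. cinner (fst ?p) (fst q) = cinner (snd ?p) (snd q)}"
      by (intro closed_Collect_eq continuous_intros)
  qed (simp add: cinner_stinespring[OF \<pi>V] cinner_stinespring[OF \<rho>W])
qed

lemma G_isometric: "p \<in> G \<Longrightarrow> norm (fst p) = norm (snd p)"
  using G_cinner[of p p] by (simp add: cinner_self del: of_real_power)

text \<open>Since \<open>G\<close> is isometric, projecting commutes with taking the closure; hence
  every vector of \<open>S\<close> has a partner, not just those of a dense subspace.\<close>

lemma fst_G: "fst ` G = S"
proof -
  have "fst ` pairs = {\<pi> a (V v) | a v. True}" by (force simp: intertwining_pairs_def)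
  then have "fst ` cspan pairs = generated_space \<pi> V"
    by (simp add: image_cspan generated_space_def)
  then show ?thesis
    using isometric_graph_image_closure(1)[of "cspan pairs"] G_isometric closure_subset
    by (metis complex_vector.subspace_span subset_iff)
qed

lemma snd_G: "snd ` G = S'"
proof -
  have "snd ` pairs = {\<rho> a (W v) | a v. True}" by (force simp: intertwining_pairs_def)
  then have "snd ` cspan pairs = generated_space \<rho> W"
    by (simp add: image_cspan generated_space_def)
  then show ?thesis
    using isometric_graph_image_closure(2)[of "cspan pairs"] G_isometric closure_subset
    by (metis complex_vector.subspace_span subset_iff)
qed

text \<open>Multiplicativity sends the generator for \<open>b\<close> and \<open>v\<close> to the
  one for \<open>a * b\<close> and \<open>v\<close>.\<close>

lemma G_invariant:
  assumes "p \<in> G"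
  shows "(\<pi> a (fst p), \<rho> a (snd p)) \<in> G"
  using assms
proof (rule G_induct)
  show "complex_vector.subspace {p. (\<pi> a (fst p), \<rho> a (snd p)) \<in> G}"
  proof (rule complex_vector.subspaceI)
    show "0 \<in> {p. (\<pi> a (fst p), \<rho> a (snd p)) \<in> G}"
      using complex_vector.subspace_0[OF G_subspace]
      by (simp add: bounded_clinear_zero[OF bounded_\<pi>] bounded_clinear_zero[OF bounded_\<rho>] zero_prod_def)
    show "p + q \<in> {p. (\<pi> a (fst p), \<rho> a (snd p)) \<in> G}"
      if "p \<in> {p. (\<pi> a (fst p), \<rho> a (snd p)) \<in> G}" "q \<in> {p. (\<pi> a (fst p), \<rho> a (snd p)) \<in> G}"
      for p q
      using that complex_vector.subspace_add[OF G_subspace]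
      by (fastforce simp: bounded_clinear_add[OF bounded_\<pi>] bounded_clinear_add[OF bounded_\<rho>])
    show "c *\<^sub>C p \<in> {p. (\<pi> a (fst p), \<rho> a (snd p)) \<in> G}"
      if "p \<in> {p. (\<pi> a (fst p), \<rho> a (snd p)) \<in> G}" for c p
      using that complex_vector.subspace_scale[OF G_subspace, of "(\<pi> a (fst p), \<rho> a (snd p))" c]
      by (simp add: bounded_clinear_scaleC[OF bounded_\<pi>] bounded_clinear_scaleC[OF bounded_\<rho>] scaleC_prod_def)
  qed
  have "continuous_on UNIV (\<lambda>p. (\<pi> a (fst p), \<rho> a (snd p)))"
    by (intro continuous_intros bounded_clinear_continuous_on[OF bounded_\<pi>]
        bounded_clinear_continuous_on[OF bounded_\<rho>])
  then show "closed {p. (\<pi> a (fst p), \<rho> a (snd p)) \<in> G}"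
    using closed_vimage[of G] by (auto simp: vimage_def)
next
  fix b v
  have "(\<pi> a (\<pi> b (V v)), \<rho> a (\<rho> b (W v))) \<in> pairs"
    using pairsI[of "a * b" v] rep_\<pi> rep_\<rho> by (simp add: representation_def)
  then show "(\<pi> a (fst (\<pi> b (V v), \<rho> b (W v))), \<rho> a (snd (\<pi> b (V v), \<rho> b (W v)))) \<in> G"
    using pairs_subset_G by auto
qed

text \<open>Only the action of \<open>M\<close> on \<open>G\<close> enters, so this serves both the
  constructed \<open>L\<close> and an arbitrary morphism.\<close>

lemma unitary_intertwiner_of_graph:
  assumes "\<And>x y. (x, y) \<in> G \<Longrightarrow> M x = y"
  shows "unitary_intertwiner_on \<pi> S \<rho> S' M"
  unfolding unitary_intertwiner_on_def fst_G[symmetric] snd_G[symmetric]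
proof (intro conjI allI ballI)
  show "\<pi> a ` fst ` G \<subseteq> fst ` G" for a using G_invariant by force
  show "\<rho> a ` snd ` G \<subseteq> snd ` G" for a using G_invariant by force
  show "M ` fst ` G = snd ` G" using assms by force
  show "cinner (M x) (M y) = cinner x y" if "x \<in> fst ` G" "y \<in> fst ` G" for x y
    using that assms G_cinner by fastforce
  show "M (\<pi> a x) = \<rho> a (M x)" if "x \<in> fst ` G" for a x
    using that assms G_invariant by fastforce
qed

section \<open>Morphisms: comparison with the graph, existence and uniqueness\<close>

lemma morphism_graph:
  assumes M: "anchored_morphism \<pi> V \<rho> W id M" and "(x, y) \<in> G"
  shows "M x = y"
proof -
  have bM: "bounded_clinear M" and M\<pi>: "\<And>a x. M (\<pi> a x) = \<rho> a (M x)" and MV: "\<And>v. M (V v) = W v"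
    using M by (auto simp: anchored_morphism_def fun_eq_iff)
  have "M (fst (x, y)) = snd (x, y)"
    using assms(2)
  proof (rule G_induct)
    show "complex_vector.subspace {p. M (fst p) = snd p}"
      by (rule complex_vector.subspaceI) (auto simp: bounded_clinear_simps[OF bM])
    show "closed {p. M (fst p) = snd p}"
      by (intro closed_Collect_eq continuous_intros bounded_clinear_continuous_on[OF bM])
  qed (simp add: M\<pi> MV)
  then show ?thesis by simp
qed

text \<open>In other words, the adjoint of \<open>M\<close> runs the graph backwards. The third
  morphism condition moves \<open>W\<close> across to \<open>V\<close>, and the intertwining
  relation moves the algebra element.\<close>

lemma morphism_cinner:
  assumes M: "anchored_morphism \<pi> V \<rho> W id M" and "(x, y) \<in> G"
  shows "cinner y (M t) = cinner x t"
proof -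
  have M\<pi>: "\<And>a x. M (\<pi> a x) = \<rho> a (M x)" and MV: "\<And>x. cadjoint W (M x) = cadjoint V x"
    using M by (auto simp: anchored_morphism_def fun_eq_iff)
  have "cinner (snd (x, y)) (M t) = cinner (fst (x, y)) t"
    using assms(2)
  proof (rule G_induct)
    show "complex_vector.subspace {p. cinner (snd p) (M t) = cinner (fst p) t}"
      by (rule complex_vector.subspaceI) (auto simp: cinner_add_left cinner_scaleC_left)
    show "closed {p. cinner (snd p) (M t) = cinner (fst p) t}"
      by (intro closed_Collect_eq continuous_intros)
  next
    fix a v
    have "cinner (\<rho> a (W v)) (M t) = cinner (W v) (M (\<pi> (star a) t))"
      by (simp add: cinner_representation[OF rep_\<rho>] M\<pi>)
    also have "\<dots> = cinner v (cadjoint V (\<pi> (star a) t))"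
      by (simp add: cinner_cadjoint_right[OF bounded_W, symmetric] MV)
    also have "\<dots> = cinner (\<pi> a (V v)) t"
      by (simp add: cinner_cadjoint_right[OF bounded_V] cinner_representation[OF rep_\<pi>])
    finally show "cinner (snd (\<pi> a (V v), \<rho> a (W v))) (M t) = cinner (fst (\<pi> a (V v), \<rho> a (W v))) t"
      by simp
  qed
  then show ?thesis by simp
qed

text \<open>If \<open>s\<close> in \<open>S\<close> has partner \<open>y\<close>, then
  \<open>cinner s x = cinner y (M x) = 0\<close>.\<close>

lemma morphism_kernel:
  assumes "anchored_morphism \<pi> V \<rho> W id M" "M x = 0"
  shows "x \<in> orthogonal_complement S"
  unfolding fst_G[symmetric] orthogonal_complement_def
  using morphism_cinner[OF assms(1), of _ _ x] assms(2) by fastforce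

lemma G_cadjoint:
  assumes "(x, y) \<in> G"
  shows "cadjoint V x = cadjoint W y"
proof (rule cinner_right_eqI)
  show "cinner v (cadjoint V x) = cinner v (cadjoint W y)" for v
    using G_cinner[OF pair_V_W assms, of v]
    by (simp add: cinner_cadjoint_right[OF bounded_V] cinner_cadjoint_right[OF bounded_W])
qed

lemma S_decomposition:
  obtains p y q where "x = p + q" "(p, y) \<in> G" "q \<in> orthogonal_complement S"
proof -
  have "complex_vector.subspace S"
    unfolding generated_space_def by (intro subspace_closure complex_vector.subspace_span)
  then obtain p where "p \<in> S" "x - p \<in> orthogonal_complement S"
    using projection_exists by blast
  then show ?thesis using that[of p "x - p"] fst_G by force
qed

text \<open>Each condition is checked on \<open>S\<close> and on its orthogonal complement. On
  \<open>S\<close> it follows from the graph (\<open>G_invariant\<close>,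
  \<open>G_cadjoint\<close>); on the complement both sides vanish.\<close>

lemma morphism_of_graph:
  assumes L: "bounded_clinear L" and L_graph: "\<And>x y. (x, y) \<in> G \<Longrightarrow> L x = y"
    and L_orth: "\<And>x. x \<in> orthogonal_complement S \<Longrightarrow> L x = 0"
  shows "anchored_morphism \<pi> V \<rho> W id L"
  unfolding anchored_morphism_def
proof (intro conjI allI)
  show "bounded_clinear (id :: 'k \<Rightarrow> 'k)"
    by (simp add: bounded_clinear_def id_def)
  show "bounded_clinear L" by fact
  show "L \<circ> V = W \<circ> id" using L_graph pair_V_W by (auto simp: fun_eq_iff)
  show "L \<circ> \<pi> a = \<rho> a \<circ> L" for a
  proof
    fix x
    obtain p y q where x: "x = p + q" and p: "(p, y) \<in> G" and q: "q \<in> orthogonal_complement S"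
      using S_decomposition by blast
    \<comment> \<open>The complement of \<open>S\<close> is invariant because \<open>S\<close> is
      invariant under \<open>\<pi> (star a)\<close>, the adjoint of \<open>\<pi> a\<close>.\<close>
    have "cinner s (\<pi> a q) = 0" if "s \<in> S" for s
    proof -
      have "\<pi> (star a) s \<in> S" using that G_invariant unfolding fst_G[symmetric] by force
      then have "cinner (\<pi> (star a) s) q = 0" using q by (simp add: orthogonal_complement_def)
      then show ?thesis by (simp add: cinner_representation_star[OF rep_\<pi>])
    qed
    then have "\<pi> a q \<in> orthogonal_complement S" by (simp add: orthogonal_complement_def)
    then have "L (\<pi> a x) = L (\<pi> a p)"
      using L_orth by (simp add: x bounded_clinear_add[OF bounded_\<pi>] bounded_clinear_add[OF L])
    also have "\<dots> = \<rho> a y" using L_graph G_invariant[OF p] by simp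
    also have "y = L x" using L_graph[OF p] L_orth[OF q] by (simp add: x bounded_clinear_add[OF L])
    finally show "(L \<circ> \<pi> a) x = (\<rho> a \<circ> L) x" by simp
  qed
  show "id \<circ> cadjoint V = cadjoint W \<circ> L"
  proof
    fix x
    obtain p y q where x: "x = p + q" and p: "(p, y) \<in> G" and q: "q \<in> orthogonal_complement S"
      using S_decomposition by blast
    \<comment> \<open>The range of \<open>V\<close> lies in \<open>S\<close>, so
      \<open>cadjoint V\<close> vanishes on the complement of \<open>S\<close>.\<close>
    have "V v \<in> S" for v using pair_V_W unfolding fst_G[symmetric] by force
    then have "cinner v (cadjoint V q) = cinner v 0" for v
      using q by (simp add: cinner_cadjoint_right[OF bounded_V] orthogonal_complement_def)
    then have "cadjoint V q = 0" by (rule cinner_right_eqI)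
    then have "cadjoint V x = cadjoint W y"
      using G_cadjoint[OF p] by (simp add: x bounded_clinear_add[OF bounded_clinear_cadjoint[OF bounded_V]])
    also have "y = L x" using L_graph[OF p] L_orth[OF q] by (simp add: x bounded_clinear_add[OF L])
    finally show "(id \<circ> cadjoint V) x = (cadjoint W \<circ> L) x" by simp
  qed
qed

text \<open>With both anchors fixed, the morphism conditions are affine in the operator, and the
  coefficients 2 and -1 add up to 1.\<close>

lemma morphism_reflection:
  assumes L: "anchored_morphism \<pi> V \<rho> W id L" and M: "anchored_morphism \<pi> V \<rho> W id M"
  shows "anchored_morphism \<pi> V \<rho> W id (\<lambda>x. L x + L x - M x)"
proof -
  have bl: "bounded_clinear L" "bounded_clinear M" using L M by (auto simp: anchored_morphism_def)
  have "bounded_linear (\<lambda>x. L x + L x - M x)"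
    by (rule bounded_linear_sub[OF bounded_linear_add]; rule bounded_clinear_bounded_linear; fact bl)
  then have "bounded_clinear (\<lambda>x. L x + L x - M x)"
    by (simp add: bounded_clinear_def scaleC_add_right complex_vector.scale_right_diff_distrib
        bounded_clinear_scaleC[OF bl(1)] bounded_clinear_scaleC[OF bl(2)])
  moreover have "cadjoint W (L x + L x - M x) = cadjoint W (L x) + cadjoint W (L x) - cadjoint W (M x)" for x
    using bounded_clinear_cadjoint[OF bounded_W] by (metis bounded_clinear_add bounded_clinear_diff)
  moreover have "\<rho> a (L x + L x - M x) = \<rho> a (L x) + \<rho> a (L x) - \<rho> a (M x)" for a x
    using bounded_\<rho> by (metis bounded_clinear_add bounded_clinear_diff)
  ultimately show ?thesis
    using L M by (simp add: anchored_morphism_def fun_eq_iff)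
qed

text \<open>Comparing \<open>M\<close> with \<open>L\<close> directly leaves open how
  \<open>M\<close> acts on the complement of \<open>S\<close>, where \<open>L\<close> vanishes. The
  reflection of \<open>M\<close> in \<open>L\<close> agrees with \<open>M\<close> on
  \<open>S\<close> and is \<open>- M\<close> on the complement, so its agreement with
  \<open>M\<close> excludes any such action.\<close>

lemma partial_isometry_unique:
  assumes L: "anchored_morphism \<pi> V \<rho> W id L"
    and L_orth: "\<And>x. x \<in> orthogonal_complement S \<Longrightarrow> L x = 0"
    and M: "anchored_morphism \<pi> V \<rho> W id M"
    and M_agree: "\<And>N x. anchored_morphism \<pi> V \<rho> W id N \<Longrightarrow>
      x \<in> initial_space N \<inter> initial_space M \<Longrightarrow> N x = M x"
  shows "M = L"
proof
  fix x
  have bl: "bounded_clinear L" "bounded_clinear M" using L M by (auto simp: anchored_morphism_def)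
  let ?N = "\<lambda>x. L x + L x - M x"
  have N: "anchored_morphism \<pi> V \<rho> W id ?N" using L M by (rule morphism_reflection)
  \<comment> \<open>Either kernel is orthogonal to \<open>S\<close>, so \<open>L x = 0\<close> and
    \<open>?N x\<close> is just \<open>- M x\<close>.\<close>
  have "?N x = 0 \<longleftrightarrow> M x = 0" for x
  proof
    assume "?N x = 0"
    with L_orth[OF morphism_kernel[OF N this]] show "M x = 0" by simp
  next
    assume "M x = 0"
    with L_orth[OF morphism_kernel[OF M this]] show "?N x = 0" by simp
  qed
  then have init: "initial_space ?N = initial_space M" by (simp add: initial_space_def)
  \<comment> \<open>Splits \<open>x\<close> along the kernel of \<open>M\<close>, where
    \<open>L\<close> vanishes too, and the initial space of \<open>M\<close>, where the agreement
    hypothesis applies.\<close>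
  obtain p where p: "M p = 0" "x - p \<in> initial_space M"
    using projection_exists[OF kernel_subspace[OF bl(2)] kernel_closed[OF bl(2)], of x]
    unfolding initial_space_def by blast
  have "?N (x - p) = M (x - p)" using M_agree[OF N] p(2) init by blast
  then have "2 *\<^sub>R L (x - p) = 2 *\<^sub>R M (x - p)" by (simp add: scaleR_2 algebra_simps)
  then have "L (x - p) = M (x - p)" by simp
  moreover have "L p = 0" using L_orth morphism_kernel[OF M p(1)] by blast
  ultimately show "M x = L x"
    using p(1) by (simp add: bounded_clinear_diff[OF bl(1)] bounded_clinear_diff[OF bl(2)])
qed

end

text \<open>The parenthetical consequence in (iii) concerns \<open>M\<close> alone, so it stands as
  a separate conjunct outside the unique existence.\<close>

theorem theorem6p29:
  fixes \<phi> :: "'a::cstar_algebra \<Rightarrow> 'k::chilbert_space \<Rightarrow> 'k"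
    and \<pi> :: "'a \<Rightarrow> 'h::chilbert_space \<Rightarrow> 'h" and V :: "'k \<Rightarrow> 'h"
    and \<rho> :: "'a \<Rightarrow> 'i::chilbert_space \<Rightarrow> 'i" and W :: "'k \<Rightarrow> 'i"
  assumes "ocp_map \<phi>"
    and "stinespring_representation \<phi> \<pi> V"
    and "stinespring_representation \<phi> \<rho> W"
  shows "(\<exists>!L :: 'h \<Rightarrow> 'i. partial_isometry L
            \<and> anchored_morphism \<pi> V \<rho> W id L
            \<and> unitary_intertwiner_on \<pi> (closure (generated_space \<pi> V))
                 \<rho> (closure (generated_space \<rho> W)) L
            \<and> (\<forall>M :: 'h \<Rightarrow> 'i. anchored_morphism \<pi> V \<rho> W id M \<longrightarrow>
                 (\<forall>x \<in> initial_space M \<inter> initial_space L. M x = L x)))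
       \<and> (\<forall>M :: 'h \<Rightarrow> 'i. anchored_morphism \<pi> V \<rho> W id M \<longrightarrow>
            unitary_intertwiner_on \<pi> (closure (generated_space \<pi> V))
              \<rho> (closure (generated_space \<rho> W)) M)"
proof -
  interpret two_stinespring \<phi> \<pi> V \<rho> W using assms(2,3) by unfold_locales
  have "closed (fst ` G)" by (simp add: fst_G)
  then obtain L where L: "partial_isometry L" and L_graph: "\<And>x y. (x, y) \<in> G \<Longrightarrow> L x = y"
    and L_orth: "\<And>x. x \<in> orthogonal_complement S \<Longrightarrow> L x = 0" and L_init: "initial_space L \<subseteq> fst ` G"
    using partial_isometry_of_graph[OF G_subspace _ G_isometric] unfolding fst_G by metis
  have mor: "anchored_morphism \<pi> V \<rho> W id L"
    using L L_graph L_orth by (intro morphism_of_graph) (auto simp: partial_isometry_def)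
  \<comment> \<open>The initial space of \<open>L\<close> lies in \<open>S\<close>, where both
    operators are given by the graph.\<close>
  have agree: "M x = L x"
    if "anchored_morphism \<pi> V \<rho> W id M" "x \<in> initial_space M \<inter> initial_space L" for M x
    using that L_init morphism_graph[OF that(1)] L_graph by fastforce
  show ?thesis
  proof (intro conjI ex1I[of _ L] allI impI ballI)
    show "M = L" if "partial_isometry M \<and> anchored_morphism \<pi> V \<rho> W id M
        \<and> unitary_intertwiner_on \<pi> S \<rho> S' M
        \<and> (\<forall>N. anchored_morphism \<pi> V \<rho> W id N \<longrightarrow>
             (\<forall>x \<in> initial_space N \<inter> initial_space M. N x = M x))" for M
      using that by (intro partial_isometry_unique[OF mor L_orth]) blast+
    show "unitary_intertwiner_on \<pi> S \<rho> S' L" using L_graph by (rule unitary_intertwiner_of_graph)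
    show "unitary_intertwiner_on \<pi> S \<rho> S' M" if "anchored_morphism \<pi> V \<rho> W id M" for M
      using morphism_graph[OF that] by (rule unitary_intertwiner_of_graph)
  qed (use L mor agree in auto)
qed

end
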